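(* Consider the Scarf-Hirota model with endowment matrix $A$ satisfying $A\mathbf{u}=\mathbf{u}$, $\mathbf{u}^TA=\mathbf{u}^T$ (with $\mathbf{u}=(1,1,1)^T$), with parameters $d_1,d_2,d_3\ge 0$ and $K,L$, and excess demand functions $E_i$ as defined in the context. Suppose $d_1+d_2+d_3>0$ and $$\hat H=4(d_1d_2+d_2d_3+d_3d_1)-(d_1+d_2+d_3)^2+(K-L)^2>0.$$ Then, for every real $\gamma\ge0$, the fixed point $\mathbf{p}^*=(1,1,1)^T$ of the system of ordinary differential equations $$\frac{dp_i}{dt}=p_i^{\gamma}E_i(\mathbf{p}),\qquad i=1,2,3,$$ is (locally) asymptotically stable for the flow restricted to the invariant surface $S_\gamma=\{\mathbf{p} : p_1,p_2,p_3>0,\ g_\gamma(\mathbf{p})=g_\gamma(\mathbf{p}^* )\}$.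
   Context: Scarf-Hirota model: $\mathbf{a}_h=(a_{1h},a_{2h},a_{3h})^T$ is the initial endowment vector of consumer $h$ ($h=1,2,3$), and $A=[\mathbf{a}_1,\mathbf{a}_2,\mathbf{a}_3]=(a_{ih})$ is the real $3\times 3$ matrix with columns $\mathbf{a}_h$. It is assumed that $A\mathbf{u}=\mathbf{u}$ and $\mathbf{u}^TA=\mathbf{u}^T$ with $\mathbf{u}=(1,1,1)^T$. Such a matrix is written $$A=\begin{bmatrix} d_1 & d_3+L & d_2+K\\ d_3+K & d_2 & d_1+L\\ d_2+L & d_1+K & d_3\end{bmatrix},$$ with real parameters $d_1\ge0$, $d_2\ge0$, $d_3\ge0$, $K$, $L$ satisfying $d_1+d_2+d_3+K+L=1$. Let $\mathbf{b}_1=(0,1,1)^T$, $\mathbf{b}_2=(1,0,1)^T$, $\mathbf{b}_3=(1,1,0)^T$, $B=[\mathbf{b}_1,\mathbf{b}_2,\mathbf{b}_3]$. For $\mathbf{p}=(p_1,p_2,p_3)^T$ put $f_h=\dfrac{\mathbf{p}^T\mathbf{a}_h}{\mathbf{p}^T\mathbf{b}_h}$, $\mathbf{f}=(f_1,f_2,f_3)^T$. The excess demand vector is $\mathbf{E}(\mathbf{p})=(E_1,E_2,E_3)^T=B\mathbf{f}-A\mathbf{u}$; thus $E_1=f_2+f_3-1$, $E_2=f_3+f_1-1$, $E_3=f_1+f_2-1$. The function $g_\gamma$ is $g_\gamma(\mathbf{p})=p_1^{2-\gamma}+p_2^{2-\gamma}+p_3^{2-\gamma}$ if $\gamma\ne2$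 and $g_\gamma(\mathbf{p})=p_1p_2p_3$ if $\gamma=2$; it is a first integral (constant along solutions) of the system. *)

theory Defs
  imports "HOL-Analysis.Analysis"
begin

section \<open>Autonomous differential equations and asymptotic stability\<close>

text \<open>A solution of \<open>x' = f x\<close> on the interval \<open>I\<close> that stays in the phase space \<open>X\<close>. At end points
  of \<open>I\<close> the derivative is one-sided.\<close>

definition ode_solution ::
  "('a::real_normed_vector \<Rightarrow> 'a) \<Rightarrow> 'a set \<Rightarrow> real set \<Rightarrow> (real \<Rightarrow> 'a) \<Rightarrow> bool" where
  "ode_solution f X I x \<longleftrightarrow>
     (\<forall>t\<in>I. x t \<in> X \<and> (x has_vector_derivative f (x t)) (at t within I))"

definition invariant_under ::
  "('a::real_normed_vector \<Rightarrow> 'a) \<Rightarrow> 'a set \<Rightarrow> 'a set \<Rightarrow> bool" where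
  "invariant_under f X S \<longleftrightarrow>
     S \<subseteq> X \<and>
     (\<forall>I x. is_interval I \<and> 0 \<in> I \<and> ode_solution f X I x \<and> x 0 \<in> S \<longrightarrow> (\<forall>t\<in>I. x t \<in> S))"

text \<open>No flow is presupposed: the two notions below require that every initial value in \<open>S\<close>
  near \<open>q\<close> has a solution for all \<open>t \<ge> 0\<close>, and constrain every solution with such an initial
  value (in the case of stability also solutions given only on a bounded time interval).\<close>

definition lyapunov_stable_on ::
  "('a::real_normed_vector \<Rightarrow> 'a) \<Rightarrow> 'a set \<Rightarrow> 'a set \<Rightarrow> 'a \<Rightarrow> bool" where
  "lyapunov_stable_on f X S q \<longleftrightarrow>
     (\<forall>\<epsilon>>0. \<exists>\<delta>>0. \<forall>y\<in>S. dist y q < \<delta> \<longrightarrow>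
        (\<exists>x. ode_solution f X {0..} x \<and> x 0 = y) \<and>
        (\<forall>I x. is_interval I \<and> 0 \<in> I \<and> I \<subseteq> {0..} \<and> ode_solution f X I x \<and> x 0 = y \<longrightarrow>
           (\<forall>t\<in>I. dist (x t) q < \<epsilon>)))"

definition locally_attractive_on ::
  "('a::real_normed_vector \<Rightarrow> 'a) \<Rightarrow> 'a set \<Rightarrow> 'a set \<Rightarrow> 'a \<Rightarrow> bool" where
  "locally_attractive_on f X S q \<longleftrightarrow>
     (\<exists>\<delta>>0. \<forall>y\<in>S. dist y q < \<delta> \<longrightarrow>
        (\<exists>x. ode_solution f X {0..} x \<and> x 0 = y) \<and>
        (\<forall>x. ode_solution f X {0..} x \<and> x 0 = y \<longrightarrow> (x \<longlongrightarrow> q) at_top))"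

definition asymptotically_stable_on ::
  "('a::real_normed_vector \<Rightarrow> 'a) \<Rightarrow> 'a set \<Rightarrow> 'a set \<Rightarrow> 'a \<Rightarrow> bool" where
  "asymptotically_stable_on f X S q \<longleftrightarrow>
     invariant_under f X S \<and> q \<in> S \<and> f q = 0 \<and>
     lyapunov_stable_on f X S q \<and> locally_attractive_on f X S q"


section \<open>The Scarf-Hirota model\<close>

definition ones :: "real^3" where
  "ones = vec 1"

text \<open>In the matrices below the inner vectors are the rows; consumer \<open>h\<close> belongs to column \<open>h\<close>.\<close>

definition endowment_matrix :: "real \<Rightarrow> real \<Rightarrow> real \<Rightarrow> real \<Rightarrow> real \<Rightarrow> real^3^3" where
  "endowment_matrix d1 d2 d3 K L = vector
     [vector [d1, d3 + L, d2 + K],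
      vector [d3 + K, d2, d1 + L],
      vector [d2 + L, d1 + K, d3]]"

definition demand_matrix :: "real^3^3" where
  "demand_matrix = vector
     [vector [0, 1, 1],
      vector [1, 0, 1],
      vector [1, 1, 0]]"

definition income_ratio :: "real^3^3 \<Rightarrow> real^3 \<Rightarrow> real^3" where
  "income_ratio A p = (\<chi> h. (p \<bullet> column h A) / (p \<bullet> column h demand_matrix))"

definition excess_demand :: "real^3^3 \<Rightarrow> real^3 \<Rightarrow> real^3" where
  "excess_demand A p = demand_matrix *v income_ratio A p - A *v ones"

definition price_field :: "real \<Rightarrow> real^3^3 \<Rightarrow> real^3 \<Rightarrow> real^3" where
  "price_field \<gamma> A p = (\<chi> i. (p $ i) powr \<gamma> * excess_demand A p $ i)"

definition positive_prices :: "(real^3) set" where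
  "positive_prices = {p. \<forall>i. 0 < p $ i}"

definition first_integral :: "real \<Rightarrow> real^3 \<Rightarrow> real" where
  "first_integral \<gamma> p =
     (if \<gamma> = 2 then p $ 1 * p $ 2 * p $ 3
      else (p $ 1) powr (2 - \<gamma>) + (p $ 2) powr (2 - \<gamma>) + (p $ 3) powr (2 - \<gamma>))"

definition price_surface :: "real \<Rightarrow> (real^3) set" where
  "price_surface \<gamma> = {p \<in> positive_prices. first_integral \<gamma> p = first_integral \<gamma> ones}"

end

theory Submission
  imports Defs
begin

text \<open>The excess demand is homogeneous of degree zero and satisfies Walras' law, so at \<open>(1,1,1)\<close> the Jacobian
  \<open>J\<close> of the price field kills \<open>u = (1,1,1)\<close> and maps into the plane orthogonal to
  \<open>u\<close>. Since the excess demand vanishes there, \<open>J\<close> is the Jacobian of the excess demand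
  itself, for every \<open>\<gamma>\<close>. One computes \<open>J = -C/4\<close> where \<open>C\<close> is the
  transpose of \<open>2A - B\<close>, all of whose rows and columns sum to zero; on the plane, \<open>J\<close> has
  trace \<open>\<tau> = -(d\<^sub>1 + d\<^sub>2 + d\<^sub>3)/2 < 0\<close> and determinant
  \<open>D = (3/16) H > 0\<close>, with \<open>H\<close> the quantity assumed positive. So the linearization along the
  surface is stable, and \<open>u\<close> is the direction of the gradient of the first integral there, that is, the
  normal of the surface.

  The passage from the linearization to the nonlinear flow uses the quadratic form
  \<open>V(v) = D |v|\<^sup>2 + |J v - \<tau> v|\<^sup>2\<close> in \<open>v = p - (1,1,1)\<close>. It is positive
  definite on the whole space, and by the Cayley-Hamilton relation of \<open>J\<close> its derivative along
  \<open>J\<close> is \<open>2 \<tau> D (|v|\<^sup>2 - (u \<bullet> v)\<^sup>2 / |u|\<^sup>2)\<close>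
  (\<open>lyapunov_equation_planar\<close>). On the surface \<open>u \<bullet> v\<close> is of smaller order than
  \<open>|v|\<close>, so \<open>V\<close> decays exponentially along every solution that stays near the fixed point
  (\<open>asymptotically_stable_on_level_set_if_planar_linearization\<close>). A solution starting close enough is
  therefore trapped, and converges.

  Solutions exist for all \<open>t \<ge> 0\<close> because the field is Lipschitz on a closed ball around the fixed point:
  composed with the projection onto that ball it becomes bounded and globally Lipschitz, hence has global
  solutions, and trapping keeps such a solution where the two fields agree
  (\<open>global_solution_if_trapped\<close>). Invariance of the surface is conservation of the first integral, a
  consequence of Walras' law.\<close>


section \<open>Global solutions for bounded Lipschitz fields\<close>

lemma has_integral_exp_mult:
  fixes c t :: real
  assumes "0 < c" "0 \<le> t"
  shows "((\<lambda>s. exp (c * s)) has_integral (exp (c * t) - 1) / c) {0..t}"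
proof -
  have "((\<lambda>s. exp (c * s)) has_integral (exp (c * t) / c - exp (c * 0) / c)) {0..t}"
    using assms
    by (intro fundamental_theorem_of_calculus)
       (auto intro!: derivative_eq_intros simp flip: has_real_derivative_iff_has_vector_derivative)
  then show ?thesis by (simp add: diff_divide_distrib)
qed

text \<open>Picard iteration in one step on the whole half-line: writing \<open>x t = exp (c t) z t\<close> with \<open>c\<close>
  larger than the Lipschitz constant turns the integral equation for \<open>x\<close> into a fixed-point equation
  for a contraction on the Banach space of bounded continuous functions \<open>z\<close>. Boundedness of the
  field keeps the contraction inside that space.\<close>

lemma global_solution_bounded_lipschitz:
  fixes F :: "'a::euclidean_space \<Rightarrow> 'a"
  assumes lip: "L-lipschitz_on UNIV F" and bdd: "bounded (range F)"
  shows "\<exists>x. ode_solution F UNIV {0..} x \<and> x 0 = y"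
proof -
  have L0: "0 \<le> L" using lip by (rule lipschitz_on_nonneg)
  define c where "c = L + 1"
  have c0: "0 < c" using L0 by (simp add: c_def)
  obtain M where M: "\<And>p. norm (F p) \<le> M" using bdd by (auto simp: bounded_iff)
  have M0: "0 \<le> M" using M[of 0] norm_ge_zero order_trans by blast
  \<comment> \<open>\<open>w z\<close> undoes the weight and \<open>P z\<close> is the Picard integral of \<open>w z\<close>; a fixed point of the weighted
    operator \<open>G\<close> is a \<open>z\<close> with \<open>w z = P z\<close>.\<close>
  define w :: "(real \<Rightarrow>\<^sub>C 'a) \<Rightarrow> real \<Rightarrow> 'a" where "w = (\<lambda>z s. exp (c * s) *\<^sub>R z s)"
  have contF: "continuous_on T F" for T
    using lip by (meson lipschitz_on_continuous_on continuous_on_subset subset_UNIV)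
  have contFw: "continuous_on T (\<lambda>s. F (w z s))" for T z
    unfolding w_def by (intro continuous_on_compose2[OF contF[of UNIV]] continuous_intros) auto
  have intFw: "(\<lambda>s. F (w z s)) integrable_on {0..t}" for t z
    by (intro integrable_continuous_real contFw)
  define P where "P = (\<lambda>z t. y + integral {0..t} (\<lambda>s. F (w z s)))"
  \<comment> \<open>The space of bounded continuous functions lives on the whole real line; at
    negative times \<open>G z\<close> is given its value at \<open>0\<close>.\<close>
  define G where "G = (\<lambda>z t. exp (- c * max 0 t) *\<^sub>R P z (max 0 t))"
  have dP: "(P z has_vector_derivative F (w z t)) (at t within {0..T})" if "t \<in> {0..T}" for z t T
    unfolding P_def using integral_has_vector_derivative[OF contFw that, of z]
    by (auto intro!: derivative_eq_intros)
  have dP': "(P z has_vector_derivative F (w z t)) (at t within {0..})" if "0 \<le> t" for z t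
  proof -
    have "(P z has_vector_derivative F (w z t)) (at t within {0..t+1})"
      using that by (intro dP) auto
    moreover have "at t within {0..t+1} = at t within {0..}"
      by (rule at_within_nhd[of _ "{..<t+1}"]) auto
    ultimately show ?thesis by simp
  qed
  have contP: "continuous_on {0..} (P z)" for z
    using dP' by (auto simp: continuous_on_eq_continuous_within intro: has_vector_derivative_continuous)
  have contG: "continuous_on UNIV (G z)" for z
    unfolding G_def by (intro continuous_intros continuous_on_compose2[OF contP]) auto
  have bddG: "norm (G z t) \<le> norm y + M / c" for z t
  proof -
    define r where "r = max 0 t"
    have r: "0 \<le> r" by (simp add: r_def)
    have "norm (integral {0..r} (\<lambda>s. F (w z s))) \<le> integral {0..r} (\<lambda>s. M)"
      by (intro integral_norm_bound_integral intFw) (auto intro: M)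
    then have "norm (P z r) \<le> norm y + M * r"
      unfolding P_def using r norm_triangle_ineq[of y "integral {0..r} (\<lambda>s. F (w z s))"]
      by (simp add: mult.commute)
    then have "norm (G z t) \<le> exp (- c * r) * (norm y + M * r)"
      unfolding G_def r_def[symmetric] by simp
    also have "\<dots> = exp (- c * r) * norm y + M / c * (exp (- c * r) * (c * r))"
      using c0 by (simp add: field_simps)
    also have "\<dots> \<le> 1 * norm y + M / c * 1"
    proof (intro add_mono mult_left_mono mult_right_mono)
      show "exp (- c * r) \<le> 1" using c0 r by simp
      have "exp (- c * r) * (c * r) \<le> exp (- c * r) * exp (c * r)"
        using exp_ge_add_one_self[of "c * r"] by (simp del: exp_ge_add_one_self)
      then show "exp (- c * r) * (c * r) \<le> 1" by (simp flip: exp_add)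
    qed (use M0 c0 in auto)
    finally show ?thesis by simp
  qed
  have G_bc: "G z \<in> bcontfun" for z
    unfolding bcontfun_def using contG bddG by (auto simp: bounded_iff)
  define \<Phi> where "\<Phi> = (\<lambda>z. Bcontfun (G z))"
  have \<Phi>: "apply_bcontfun (\<Phi> z) = G z" for z
    unfolding \<Phi>_def using G_bc by (rule Bcontfun_inverse)
  have "dist (\<Phi> z) (\<Phi> z') \<le> L / c * dist z z'" for z z'
  proof (rule dist_bound)
    fix t :: real
    define r where "r = max 0 t"
    have r: "0 \<le> r" by (simp add: r_def)
    let ?d = "dist z z'"
    have "norm (P z r - P z' r) = norm (integral {0..r} (\<lambda>s. F (w z s) - F (w z' s)))"
      unfolding P_def by (simp add: integral_diff intFw)
    also have "\<dots> \<le> integral {0..r} (\<lambda>s. L * ?d * exp (c * s))"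
    proof (rule integral_norm_bound_integral)
      fix s assume "s \<in> {0..r}"
      have "norm (F (w z s) - F (w z' s)) \<le> L * norm (w z s - w z' s)"
        using lipschitz_onD[OF lip] by (simp add: dist_norm)
      also have "\<dots> = L * (exp (c * s) * dist (z s) (z' s))"
        by (simp add: w_def dist_norm flip: scaleR_diff_right)
      also have "\<dots> \<le> L * (exp (c * s) * ?d)"
        using L0 by (intro mult_left_mono dist_bounded) auto
      finally show "norm (F (w z s) - F (w z' s)) \<le> L * ?d * exp (c * s)"
        by (simp add: mult_ac)
    qed (intro integrable_diff intFw integrable_continuous_real continuous_intros contFw)+
    also have "\<dots> = L * ?d * ((exp (c * r) - 1) / c)"
      using integral_unique[OF has_integral_exp_mult[OF c0 r]] by simp
    finally have "norm (P z r - P z' r) \<le> L / c * ?d * (exp (c * r) - 1)" by simp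
    then have "exp (- c * r) * norm (P z r - P z' r)
        \<le> exp (- c * r) * (L / c * ?d * (exp (c * r) - 1))"
      by (intro mult_left_mono) auto
    also have "\<dots> = L / c * ?d * (1 - exp (- c * r))"
      by (simp add: algebra_simps flip: exp_add)
    also have "\<dots> \<le> L / c * ?d * 1"
      using L0 c0 by (intro mult_left_mono) auto
    finally show "dist (apply_bcontfun (\<Phi> z) t) (apply_bcontfun (\<Phi> z') t) \<le> L / c * ?d"
      unfolding \<Phi> G_def r_def[symmetric] by (simp add: dist_norm flip: scaleR_diff_right)
  qed
  then have "\<exists>!z. \<Phi> z = z"
    using L0 by (intro banach_fix_type[of "L / c"]) (auto simp: c_def)
  then obtain z where z: "\<Phi> z = z" by blast
  have zP: "w z t = P z t" if "0 \<le> t" for t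
  proof -
    have "z t = exp (- c * t) *\<^sub>R P z t"
      using \<Phi>[of z] that by (simp add: z G_def)
    then show ?thesis by (simp add: w_def flip: exp_add)
  qed
  have "ode_solution F UNIV {0..} (P z)"
    unfolding ode_solution_def using dP'[of _ z] zP by (metis UNIV_I atLeast_iff)
  moreover have "P z 0 = y" by (simp add: P_def)
  ultimately show ?thesis by blast
qed


section \<open>Lyapunov functions on an invariant set\<close>

lemma ode_solution_subset:
  assumes "ode_solution f X I x" "J \<subseteq> I"
  shows "ode_solution f X J x"
  using assms unfolding ode_solution_def
  by (meson has_vector_derivative_within_subset subset_iff)

lemma ode_solution_continuous_on:
  assumes "ode_solution f X I x"
  shows "continuous_on I x"
  using assms unfolding ode_solution_def continuous_on_eq_continuous_within
  by (blast intro: has_vector_derivative_continuous)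

lemma first_exit_from_ball:
  fixes x :: "real \<Rightarrow> 'a::real_normed_vector"
  assumes "continuous_on {0..T} x" "0 \<le> T" "dist (x 0) q < r" "r \<le> dist (x T) q"
  obtains \<tau> where "0 \<le> \<tau>" "\<tau> \<le> T" "dist (x \<tau>) q = r" "\<And>t. t \<in> {0..\<tau>} \<Longrightarrow> x t \<in> cball q r"
proof -
  have cont: "continuous_on {0..T} (\<lambda>t. dist (x t) q)"
    by (intro continuous_intros assms)
  define E where "E = {t \<in> {0..T}. r \<le> dist (x t) q}"
  have "closed E"
    unfolding E_def by (intro continuous_on_closed_Collect_le continuous_on_const cont closed_atLeastAtMost)
  moreover have "E \<noteq> {}" "bdd_below E"
    unfolding E_def using assms by (auto intro!: bdd_belowI[of _ 0])
  ultimately have E: "closed E" "E \<noteq> {}" "bdd_below E" by blast+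
  define \<tau> where "\<tau> = Inf E"
  have \<tau>: "\<tau> \<in> E" unfolding \<tau>_def by (rule closed_contains_Inf[OF E(2,3,1)])
  have before: "dist (x t) q < r" if "t \<in> {0..<\<tau>}" for t
  proof (rule ccontr)
    assume "\<not> dist (x t) q < r"
    then have "t \<in> E" using that \<tau> by (auto simp: E_def)
    then have "\<tau> \<le> t" unfolding \<tau>_def by (intro cInf_lower E)
    with that show False by simp
  qed
  have "\<exists>s\<ge>0. s \<le> \<tau> \<and> dist (x s) q = r"
    using \<tau> assms(2,3)
    by (intro IVT') (auto simp: E_def intro!: continuous_on_subset[OF cont])
  then have "dist (x \<tau>) q = r"
    using before by (metis atLeastLessThan_iff less_irrefl order_le_less)
  moreover from this before have "x t \<in> cball q r" if "t \<in> {0..\<tau>}" for t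
    using that by (cases "t = \<tau>") (auto simp: dist_commute less_imp_le)
  ultimately show ?thesis using that \<tau> by (auto simp: E_def)
qed

text \<open>Composing with the projection onto the ball gives a bounded, globally Lipschitz field, so a
  global solution of the modified equation exists. Until its first exit from the ball it solves
  the original equation, and then the trapping hypothesis, applied up to the exit time, forbids
  the exit.\<close>

lemma global_solution_if_trapped:
  fixes f :: "'a::euclidean_space \<Rightarrow> 'a"
  assumes lip: "L-lipschitz_on (cball q r) f" and X: "cball q r \<subseteq> X" and y: "dist y q < r"
    and trapped: "\<And>x T. \<lbrakk>0 \<le> T; ode_solution f X {0..T} x; x 0 = y\<rbrakk> \<Longrightarrow> dist (x T) q < r"
  shows "\<exists>x. ode_solution f X {0..} x \<and> x 0 = y"
proof -
  have r0: "0 < r" using y by (meson le_less_trans zero_le_dist)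
  define \<pi> where "\<pi> = closest_point (cball q r)"
  have \<pi>_in: "\<pi> p \<in> cball q r" for p
    unfolding \<pi>_def using r0 by (intro closest_point_in_set) auto
  have \<pi>_id: "\<pi> p = p" if "p \<in> cball q r" for p
    unfolding \<pi>_def using that by (rule closest_point_self)
  have "L-lipschitz_on UNIV (\<lambda>p. f (\<pi> p))"
  proof (rule lipschitz_onI)
    fix p p'
    have "dist (f (\<pi> p)) (f (\<pi> p')) \<le> L * dist (\<pi> p) (\<pi> p')"
      by (rule lipschitz_onD[OF lip \<pi>_in \<pi>_in])
    also have "\<dots> \<le> L * dist p p'"
      unfolding \<pi>_def using r0 lipschitz_on_nonneg[OF lip]
      by (intro mult_left_mono closest_point_lipschitz) auto
    finally show "dist (f (\<pi> p)) (f (\<pi> p')) \<le> L * dist p p'" .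
  qed (rule lipschitz_on_nonneg[OF lip])
  moreover have "compact (f ` cball q r)"
    by (intro compact_continuous_image lipschitz_on_continuous_on[OF lip] compact_cball)
  then have "bounded (range (\<lambda>p. f (\<pi> p)))"
    by (rule bounded_subset[OF compact_imp_bounded]) (use \<pi>_in in auto)
  ultimately obtain x where x: "ode_solution (\<lambda>p. f (\<pi> p)) UNIV {0..} x" "x 0 = y"
    using global_solution_bounded_lipschitz[of L "\<lambda>p. f (\<pi> p)" y] by blast
  have solves: "ode_solution f X I x" if "I \<subseteq> {0..}" "\<And>t. t \<in> I \<Longrightarrow> x t \<in> cball q r" for I
    using ode_solution_subset[OF x(1) that(1)] that(2) X
    unfolding ode_solution_def by (auto simp: \<pi>_id simp del: mem_cball)
  have inside: "dist (x T) q < r" if "0 \<le> T" for T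
  proof (rule ccontr)
    assume "\<not> dist (x T) q < r"
    moreover have "continuous_on {0..T} x"
      using ode_solution_continuous_on[OF x(1)] by (rule continuous_on_subset) auto
    ultimately obtain \<tau> where \<tau>: "0 \<le> \<tau>" "dist (x \<tau>) q = r" "\<And>t. t \<in> {0..\<tau>} \<Longrightarrow> x t \<in> cball q r"
      using first_exit_from_ball[of T x q r] \<open>0 \<le> T\<close> y x(2) by (metis not_less)
    have "dist (x \<tau>) q < r"
      using \<tau> by (intro trapped solves x) auto
    with \<tau> show False by simp
  qed
  have "ode_solution f X {0..} x"
    using inside by (intro solves) (auto simp: dist_commute less_imp_le)
  with x(2) show ?thesis by blast
qed

lemma exponential_decay:
  fixes v v' :: "real \<Rightarrow> real"
  assumes "0 \<le> T"
    and v: "\<And>t. t \<in> {0..T} \<Longrightarrow> (v has_real_derivative v' t) (at t within {0..T})"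
    and le: "\<And>t. t \<in> {0..T} \<Longrightarrow> v' t \<le> - c * v t"
  shows "v T \<le> exp (- c * T) * v 0"
proof -
  define u where "u = (\<lambda>t. exp (c * t) * v t)"
  have u: "(u has_real_derivative exp (c * t) * (c * v t + v' t)) (at t within {0..T})"
    if "t \<in> {0..T}" for t
    unfolding u_def using v[OF that]
    by (auto intro!: derivative_eq_intros simp: algebra_simps)
  have "u T \<le> u 0"
  proof (rule DERIV_nonpos_imp_decreasing_open[OF \<open>0 \<le> T\<close>])
    show "continuous_on {0..T} u"
      using u by (rule DERIV_continuous_on)
    fix t assume t: "0 < t" "t < T"
    then have "at t within {0..T} = at t" by (intro at_within_interior) simp
    then show "\<exists>d. DERIV u t :> d \<and> d \<le> 0"
      using u[of t] le[of t] t by (auto intro!: exI mult_nonneg_nonpos)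
  qed
  then have "exp (- c * T) * u T \<le> exp (- c * T) * v 0"
    by (simp add: u_def)
  then show ?thesis by (simp add: u_def flip: mult.assoc exp_add)
qed

text \<open>Only decay of \<open>V\<close> on the invariant set \<open>S\<close> is required, while the solutions live in the larger
  phase space \<open>X\<close>: this avoids charts on \<open>S\<close>. The two quadratic bounds convert exponential decay of
  \<open>V\<close> into trapping and convergence.\<close>

theorem asymptotically_stable_on_if_Lyapunov_function:
  fixes f :: "'a::euclidean_space \<Rightarrow> 'a" and V :: "'a \<Rightarrow> real"
  assumes inv: "invariant_under f X S" and qS: "q \<in> S" and fq: "f q = 0"
    and r: "0 < r" "cball q r \<subseteq> X" and lip: "L-lipschitz_on (cball q r) f"
    and V: "\<And>p. (V has_derivative V' p) (at p)"
    and a: "0 < a" and lower: "\<And>p. a * (dist p q)\<^sup>2 \<le> V p"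
    and b: "0 < b" and upper: "\<And>p. V p \<le> b * (dist p q)\<^sup>2"
    and c: "0 < c" and decay: "\<And>p. p \<in> S \<Longrightarrow> p \<in> cball q r \<Longrightarrow> V' p (f p) \<le> - c * V p"
  shows "asymptotically_stable_on f X S q"
proof -
  have stay: "x t \<in> S" if "is_interval I" "0 \<in> I" "ode_solution f X I x" "x 0 \<in> S" "t \<in> I" for I x t
    using inv that unfolding invariant_under_def by blast
  have V_decay: "V (x T) \<le> exp (- c * T) * V (x 0)"
    if T: "0 \<le> T" and sol: "ode_solution f X {0..T} x" and S: "x 0 \<in> S"
      and ball: "\<And>t. t \<in> {0..T} \<Longrightarrow> x t \<in> cball q r" for x T
  proof (rule exponential_decay[OF T])
    fix t assume t: "t \<in> {0..T}"
    have dx: "(x has_vector_derivative f (x t)) (at t within {0..T})"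
      using sol t unfolding ode_solution_def by blast
    show "((\<lambda>t. V (x t)) has_real_derivative V' (x t) (f (x t))) (at t within {0..T})"
      using vector_derivative_diff_chain_within[OF dx, of V "V' (x t)"] V
      by (auto simp: has_real_derivative_iff_has_vector_derivative o_def intro: has_derivative_at_withinI)
    show "V' (x t) (f (x t)) \<le> - c * V (x t)"
      using stay[OF _ _ sol S t] T ball[OF t] by (intro decay) (auto simp: is_interval_cc)
  qed
  \<comment> \<open>Starting within \<open>\<epsilon> * sqrt (a / (a + b))\<close>, the value of \<open>V\<close> is below \<open>a * \<epsilon>\<^sup>2\<close>, a lower bound for
    \<open>V\<close> on the sphere of radius \<open>\<epsilon>\<close>; this factor is strictly less than both \<open>sqrt (a / b)\<close> and \<open>1\<close>.\<close>
  have trap: "dist (x T) q < \<epsilon>"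
    if \<epsilon>: "0 < \<epsilon>" "\<epsilon> \<le> r" and T: "0 \<le> T" and sol: "ode_solution f X {0..T} x" and S: "x 0 \<in> S"
      and small: "dist (x 0) q < \<epsilon> * sqrt (a / (a + b))" for x T \<epsilon>
  proof (rule ccontr)
    assume far: "\<not> dist (x T) q < \<epsilon>"
    have sq: "(sqrt (a / (a + b)))\<^sup>2 = a / (a + b)" and "sqrt (a / (a + b)) \<le> 1"
      using a b by auto
    then have "dist (x 0) q < \<epsilon>"
      using small \<epsilon> mult_left_mono[of "sqrt (a / (a + b))" 1 \<epsilon>] by linarith
    then obtain \<tau> where \<tau>: "0 \<le> \<tau>" "\<tau> \<le> T" "dist (x \<tau>) q = \<epsilon>" "\<And>t. t \<in> {0..\<tau>} \<Longrightarrow> x t \<in> cball q \<epsilon>"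
      using first_exit_from_ball[OF ode_solution_continuous_on[OF sol] T] far by (metis not_less)
    have "V (x \<tau>) \<le> exp (- c * \<tau>) * V (x 0)"
    proof (rule V_decay)
      show "ode_solution f X {0..\<tau>} x" using \<tau> by (intro ode_solution_subset[OF sol]) auto
      show "x t \<in> cball q r" if "t \<in> {0..\<tau>}" for t
        using \<tau>(4)[OF that] \<epsilon>(2) by simp
    qed (fact \<tau>(1) S)+
    also have "\<dots> \<le> 1 * V (x 0)"
      using c \<tau>(1) order_trans[OF _ lower[of "x 0"], of 0] a by (intro mult_right_mono) auto
    also have "1 * V (x 0) \<le> b * (dist (x 0) q)\<^sup>2" using upper by simp
    also have "\<dots> \<le> b * (\<epsilon> * sqrt (a / (a + b)))\<^sup>2"
      using small b by (intro mult_left_mono power_mono) auto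
    also have "\<dots> = a * \<epsilon>\<^sup>2 * (b / (a + b))" by (simp add: power_mult_distrib sq)
    also have "\<dots> < a * \<epsilon>\<^sup>2 * 1"
      using a b \<epsilon> by (intro mult_strict_left_mono) auto
    also have "\<dots> \<le> V (x \<tau>)" using lower[of "x \<tau>"] \<tau>(3) by simp
    finally show False by simp
  qed
  define k where "k = sqrt (a / (a + b))"
  have k: "0 < k" using a b by (simp add: k_def)
  have k1: "k \<le> 1" using a b by (simp add: k_def)
  have existence: "\<exists>x. ode_solution f X {0..} x \<and> x 0 = y" if y: "y \<in> S" "dist y q < r * k" for y
  proof (rule global_solution_if_trapped[OF lip r(2)])
    show "dist y q < r" using y(2) k1 r(1) mult_left_mono[of k 1 r] by linarith
    show "dist (x T) q < r" if x: "0 \<le> T" "ode_solution f X {0..T} x" "x 0 = y" for x T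
    proof (rule trap[OF r(1) order_refl x(1,2)])
      show "x 0 \<in> S" unfolding x(3) by (rule y(1))
      show "dist (x 0) q < r * sqrt (a / (a + b))" unfolding x(3) k_def[symmetric] by (rule y(2))
    qed
  qed
  have trap': "dist (x t) q < \<epsilon>"
    if \<epsilon>: "0 < \<epsilon>" "\<epsilon> \<le> r" and I: "is_interval I" "0 \<in> I" "I \<subseteq> {0..}" and x: "ode_solution f X I x"
      and x0: "x 0 \<in> S" "dist (x 0) q < \<epsilon> * k" and t: "t \<in> I" for \<epsilon> I x t
  proof (rule trap[OF \<epsilon>])
    show "x 0 \<in> S" by (rule x0(1))
    show "0 \<le> t" using I(3) t by auto
    have "{0..t} \<subseteq> I"
      using mem_is_interval_1_I[OF I(1,2) t] by auto
    then show "ode_solution f X {0..t} x" by (rule ode_solution_subset[OF x])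
    show "dist (x 0) q < \<epsilon> * sqrt (a / (a + b))" using x0(2) by (simp only: k_def)
  qed
  have "lyapunov_stable_on f X S q"
    unfolding lyapunov_stable_on_def
  proof (intro allI impI)
    fix \<epsilon> :: real assume "0 < \<epsilon>"
    define e where "e = min \<epsilon> r"
    have e: "0 < e" "e \<le> r" "e \<le> \<epsilon>" using \<open>0 < \<epsilon>\<close> r by (auto simp: e_def)
    show "\<exists>\<delta>>0. \<forall>y\<in>S. dist y q < \<delta> \<longrightarrow>
        (\<exists>x. ode_solution f X {0..} x \<and> x 0 = y) \<and>
        (\<forall>I x. is_interval I \<and> 0 \<in> I \<and> I \<subseteq> {0..} \<and> ode_solution f X I x \<and> x 0 = y \<longrightarrow>
           (\<forall>t\<in>I. dist (x t) q < \<epsilon>))"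
    proof (intro exI[of _ "e * k"] conjI ballI impI allI)
      show "0 < e * k" using e k by simp
      fix y assume y: "y \<in> S" "dist y q < e * k"
      show "\<exists>x. ode_solution f X {0..} x \<and> x 0 = y"
      proof (rule existence[OF y(1)])
        show "dist y q < r * k" using y(2) mult_right_mono[OF e(2), of k] k by linarith
      qed
      fix I x t
      assume "is_interval I \<and> 0 \<in> I \<and> I \<subseteq> {0..} \<and> ode_solution f X I x \<and> x 0 = y" and t: "t \<in> I"
      then have "dist (x t) q < e"
        using y by (intro trap'[OF e(1,2) _ _ _ _ _ _ t]) simp_all
      then show "dist (x t) q < \<epsilon>" using e by simp
    qed
  qed
  moreover have "locally_attractive_on f X S q"
    unfolding locally_attractive_on_def
  proof (intro exI[of _ "r * k"] conjI ballI impI allI)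
    show "0 < r * k" using r k by simp
    fix y assume y: "y \<in> S" "dist y q < r * k"
    then show "\<exists>x. ode_solution f X {0..} x \<and> x 0 = y" by (rule existence)
    fix x assume "ode_solution f X {0..} x \<and> x 0 = y"
    then have x: "ode_solution f X {0..} x" "x 0 = y" by auto
    have x0: "x 0 \<in> S" "dist (x 0) q < r * k" unfolding x(2) by (fact y)+
    have ball: "x t \<in> cball q r" if "0 \<le> t" for t
    proof -
      have "dist (x t) q < r"
      proof (rule trap'[OF r(1) order_refl _ _ _ x(1) x0])
        show "t \<in> {0..}" using that by simp
      qed (simp_all add: is_interval_ci)
      then show ?thesis by (simp add: dist_commute)
    qed
    have "(dist (x t) q)\<^sup>2 \<le> exp (- c * t) * (V y / a)" if "0 \<le> t" for t
    proof -
      have "a * (dist (x t) q)\<^sup>2 \<le> V (x t)" by (rule lower)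
      also have "\<dots> \<le> exp (- c * t) * V y"
        unfolding x(2)[symmetric]
      proof (rule V_decay[OF that])
        show "x 0 \<in> S" by (rule x0(1))
        show "ode_solution f X {0..t} x" by (rule ode_solution_subset[OF x(1)]) simp
        show "x s \<in> cball q r" if "s \<in> {0..t}" for s
          by (rule ball) (use that in simp)
      qed
      finally have "(dist (x t) q)\<^sup>2 \<le> exp (- c * t) * V y / a"
        unfolding pos_le_divide_eq[OF a] by (simp only: mult.commute)
      then show ?thesis by (simp only: times_divide_eq_right)
    qed
    then have bound: "norm ((dist (x t) q)\<^sup>2) \<le> exp (- c * t) * (V y / a)" if "0 \<le> t" for t
      using that by simp
    have "filterlim (\<lambda>t. - c * t) at_bot at_top"
      by (rule filterlim_tendsto_neg_mult_at_bot[OF tendsto_const _ filterlim_ident]) (use c in simp)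
    then have "((\<lambda>t. exp (- c * t) * (V y / a)) \<longlongrightarrow> 0 * (V y / a)) at_top"
      by (intro tendsto_mult_right filterlim_compose[OF exp_at_bot])
    then have majorant: "((\<lambda>t. exp (- c * t) * (V y / a)) \<longlongrightarrow> 0) at_top"
      by (simp only: mult_zero_left)
    have "((\<lambda>t. (dist (x t) q)\<^sup>2) \<longlongrightarrow> 0) at_top"
      by (rule Lim_null_comparison[OF eventually_mono[OF eventually_ge_at_top bound] majorant])
    then have "((\<lambda>t. sqrt ((dist (x t) q)\<^sup>2)) \<longlongrightarrow> sqrt 0) at_top"
      by (rule tendsto_real_sqrt)
    then show "(x \<longlongrightarrow> q) at_top"
      by (subst tendsto_dist_iff) simp
  qed
  ultimately show ?thesis
    unfolding asymptotically_stable_on_def using inv qS fq by blast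
qed


section \<open>Stability on a level set from a planar linearization\<close>

text \<open>In finite dimensions, continuity of \<open>f' p v\<close> in \<open>p\<close> for each fixed direction
  \<open>v\<close> already gives continuity in the operator norm, hence a bound for the derivative on the compact
  ball.\<close>

lemma C1_imp_lipschitz_on_cball:
  fixes f :: "'a::euclidean_space \<Rightarrow> 'a"
  assumes f': "\<And>p. p \<in> cball q r \<Longrightarrow> (f has_derivative f' p) (at p)"
    and cont: "\<And>v. continuous_on (cball q r) (\<lambda>p. f' p v)"
  shows "\<exists>L. L-lipschitz_on (cball q r) f"
proof -
  have lin: "bounded_linear (f' p)" if "p \<in> cball q r" for p
    using f'[OF that] by (rule has_derivative_bounded_linear)
  have "continuous_on (cball q r) (\<lambda>p. Blinfun (f' p))"
  proof (rule continuous_on_blinfun_componentwise)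
    fix i :: 'a
    show "continuous_on (cball q r) (\<lambda>p. blinfun_apply (Blinfun (f' p)) i)"
      using cont[of i] by (rule continuous_on_eq) (simp add: bounded_linear_Blinfun_apply lin)
  qed
  then have "bounded ((\<lambda>p. Blinfun (f' p)) ` cball q r)"
    by (intro compact_imp_bounded compact_continuous_image compact_cball)
  then obtain B where B: "0 < B" "\<And>p. p \<in> cball q r \<Longrightarrow> norm (Blinfun (f' p)) \<le> B"
    unfolding bounded_pos by blast
  have "norm (f x - f y) \<le> B * norm (x - y)" if "x \<in> cball q r" "y \<in> cball q r" for x y
  proof (rule differentiable_bound[OF convex_cball])
    show "(f has_derivative f' p) (at p within cball q r)" if "p \<in> cball q r" for p
      using f'[OF that] by (rule has_derivative_at_withinI)
    show "onorm (f' p) \<le> B" if "p \<in> cball q r" for p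
      using B(2)[OF that] lin[OF that] by (simp add: norm_blinfun.rep_eq bounded_linear_Blinfun_apply)
  qed (use that in auto)
  then have "B-lipschitz_on (cball q r) f"
    using B(1) by (intro lipschitz_onI) (auto simp: dist_norm)
  then show ?thesis by blast
qed

text \<open>When the orthogonal complement of \<open>u\<close> is a plane, the relation \<open>char\<close> is on it the
  Cayley-Hamilton theorem with trace \<open>\<tau>\<close> and determinant \<open>D\<close>, and
  \<open>\<tau> v - J v\<close> is the adjugate of \<open>J\<close> applied to \<open>v\<close>. The left side is half
  the derivative of \<open>D |v|\<^sup>2 + |J v - \<tau> v|\<^sup>2\<close> along \<open>v' = J v\<close>: since
  \<open>J (J v) - \<tau> J v\<close> is \<open>- D\<close> times the orthogonal projection of \<open>v\<close>, the
  two contributions of \<open>v \<bullet> J v\<close> cancel, and what survives is \<open>\<tau> D\<close> times the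
  squared norm of that projection.\<close>

lemma lyapunov_equation_planar:
  fixes J :: "'a::real_inner \<Rightarrow> 'a"
  assumes J: "linear J"
    and perp: "\<And>v. u \<bullet> J v = 0"
    and char: "\<And>v. J (J v) = \<tau> *\<^sub>R J v - D *\<^sub>R (v - ((u \<bullet> v) / (u \<bullet> u)) *\<^sub>R u)"
  shows "D * (v \<bullet> J v) + (J v - \<tau> *\<^sub>R v) \<bullet> (J (J v) - \<tau> *\<^sub>R J v)
       = \<tau> * D * (v \<bullet> v - (u \<bullet> v)\<^sup>2 / (u \<bullet> u))"
proof -
  have "(J v - \<tau> *\<^sub>R v) \<bullet> (J (J v) - \<tau> *\<^sub>R J v)
      = - D * ((J v - \<tau> *\<^sub>R v) \<bullet> v - ((u \<bullet> v) / (u \<bullet> u)) * (u \<bullet> (J v - \<tau> *\<^sub>R v)))"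
    by (simp add: char inner_diff_right inner_commute algebra_simps)
  also have "u \<bullet> (J v - \<tau> *\<^sub>R v) = - \<tau> * (u \<bullet> v)"
    by (simp add: inner_diff_right perp)
  finally show ?thesis
    by (simp add: algebra_simps inner_commute power2_eq_square)
qed

text \<open>The linearization \<open>f' q\<close> has a kernel, so it cannot decide stability in the full space. On the level
  set of \<open>g\<close> it does, because the gradient of \<open>g\<close> at \<open>q\<close> is parallel to
  \<open>u\<close>: points \<open>p\<close> of the level set satisfy
  \<open>u \<bullet> (p - q) = o(norm (p - q))\<close>, which makes the defect term in
  \<open>lyapunov_equation_planar\<close> negligible.\<close>

theorem asymptotically_stable_on_level_set_if_planar_linearization:
  fixes f :: "'a::euclidean_space \<Rightarrow> 'a" and g :: "'a \<Rightarrow> real"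
  assumes inv: "invariant_under f X S" and qS: "q \<in> S" and fq: "f q = 0"
    and X: "open X"
    and f': "\<And>p. p \<in> X \<Longrightarrow> (f has_derivative f' p) (at p)"
    and cont: "\<And>v. continuous_on X (\<lambda>p. f' p v)"
    and level: "\<And>p. p \<in> S \<Longrightarrow> g p = g q"
    and g': "(g has_derivative (\<lambda>v. \<kappa> * (u \<bullet> v))) (at q)" and \<kappa>: "\<kappa> \<noteq> 0" and u: "u \<noteq> 0"
    and perp: "\<And>v. u \<bullet> f' q v = 0"
    and char: "\<And>v. f' q (f' q v) = \<tau> *\<^sub>R f' q v - D *\<^sub>R (v - ((u \<bullet> v) / (u \<bullet> u)) *\<^sub>R u)"
    and \<tau>: "\<tau> < 0" and D: "0 < D"
  shows "asymptotically_stable_on f X S q"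
proof -
  have qX: "q \<in> X" using inv qS unfolding invariant_under_def by blast
  define J where "J = f' q"
  have J: "(f has_derivative J) (at q)" unfolding J_def using f' qX by blast
  define M where "M = (\<lambda>v. J v - \<tau> *\<^sub>R v)"
  have J_lin: "bounded_linear J" using J by (rule has_derivative_bounded_linear)
  have M_lin: "bounded_linear M"
    unfolding M_def by (intro bounded_linear_sub J_lin bounded_linear_scaleR_right)
  obtain N where N: "0 < N" "\<And>v. norm (M v) \<le> N * norm v"
    using bounded_linear.pos_bounded[OF M_lin] by (auto simp: mult.commute)
  define b where "b = D + N\<^sup>2"
  have b: "0 < b" using D by (simp add: b_def add_pos_nonneg)
  define V where "V = (\<lambda>p. D * ((p - q) \<bullet> (p - q)) + M (p - q) \<bullet> M (p - q))"
  define V' where "V' = (\<lambda>p h. 2 * (D * ((p - q) \<bullet> h) + M (p - q) \<bullet> M h))"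
  have V': "(V has_derivative V' p) (at p)" for p
    unfolding V_def V'_def
    by (auto intro!: derivative_eq_intros bounded_linear.has_derivative[OF M_lin] simp: inner_commute)
  have lower: "D * (dist p q)\<^sup>2 \<le> V p" for p
    by (simp add: V_def dist_norm power2_norm_eq_inner)
  have upper: "V p \<le> b * (dist p q)\<^sup>2" for p
  proof -
    have "(norm (M (p - q)))\<^sup>2 \<le> (N * norm (p - q))\<^sup>2"
      using N by (intro power_mono) auto
    then show ?thesis
      by (simp add: V_def b_def dist_norm power_mult_distrib algebra_simps flip: power2_norm_eq_inner)
  qed
  \<comment> \<open>The budget for the derivative of \<open>V\<close>: of the leading coefficient \<open>2 * \<tau> * D\<close>, at most a quarter
    may be lost to the component along \<open>u\<close> (through \<open>\<eta>\<close>) and a quarter to the nonlinear remainder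
    (through \<open>\<epsilon>\<close>); what remains is at most \<open>\<tau> * D\<close>.\<close>
  define \<epsilon> where "\<epsilon> = - \<tau> * D / (4 * b)"
  have \<epsilon>: "0 < \<epsilon>" using mult_neg_pos[OF \<tau> D] b by (simp add: \<epsilon>_def divide_neg_pos)
  obtain d1 where d1: "0 < d1" "\<And>p. norm (p - q) < d1 \<Longrightarrow> norm (f p - J (p - q)) \<le> \<epsilon> * norm (p - q)"
    using J \<epsilon> unfolding has_derivative_at_alt by (auto simp: fq)
  define \<eta> where "\<eta> = \<bar>\<kappa>\<bar> * norm u / 2"
  have "0 < \<eta>" using \<kappa> u by (simp add: \<eta>_def)
  then obtain d2 where d2: "0 < d2"
    "\<And>p. norm (p - q) < d2 \<Longrightarrow> norm (g p - g q - \<kappa> * (u \<bullet> (p - q))) \<le> \<eta> * norm (p - q)"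
    using g' unfolding has_derivative_at_alt by blast
  obtain d3 where d3: "0 < d3" "cball q d3 \<subseteq> X"
    using X qX open_contains_cball by blast
  define r where "r = min (min (d1 / 2) (d2 / 2)) d3"
  have r: "0 < r" "r < d1" "r < d2" "cball q r \<subseteq> X"
    using d1(1) d2(1) d3 by (auto simp: r_def)
  obtain L where L: "L-lipschitz_on (cball q r) f"
    using C1_imp_lipschitz_on_cball[of q r f f'] f' cont r(4) continuous_on_subset by blast
  define c where "c = - \<tau> * D / b"
  have c: "0 < c" using mult_neg_pos[OF \<tau> D] b by (simp add: c_def divide_neg_pos)
  have decay: "V' p (f p) \<le> - c * V p" if p: "p \<in> S" "p \<in> cball q r" for p
  proof -
    define v where "v = p - q"
    define \<rho> where "\<rho> = f p - J v"
    have v: "norm v < d1" "norm v < d2"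
      using p(2) r by (auto simp: v_def dist_norm norm_minus_commute)
    have \<rho>: "norm \<rho> \<le> \<epsilon> * norm v" using d1(2) v(1) by (simp add: \<rho>_def v_def)
    have fp: "f p = J v + \<rho>" by (simp add: \<rho>_def)
    have "\<bar>\<kappa>\<bar> * \<bar>u \<bullet> v\<bar> \<le> \<bar>\<kappa>\<bar> * (norm u * norm v / 2)"
      using d2(2)[of p] v(2) level[OF p(1)] by (simp add: v_def \<eta>_def abs_mult)
    then have "\<bar>u \<bullet> v\<bar> \<le> norm u * norm v / 2" using \<kappa> by simp
    then have "\<bar>u \<bullet> v\<bar>\<^sup>2 \<le> (norm u * norm v / 2)\<^sup>2" by (intro power_mono) auto
    then have small: "(u \<bullet> v)\<^sup>2 / (u \<bullet> u) \<le> (v \<bullet> v) / 4"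
      using u by (simp add: power_mult_distrib power_divide field_simps power2_norm_eq_inner)
    have main: "D * (v \<bullet> J v) + M v \<bullet> M (J v) \<le> \<tau> * D * (3 / 4 * (v \<bullet> v))"
    proof -
      have "D * (v \<bullet> J v) + M v \<bullet> M (J v) = \<tau> * D * (v \<bullet> v - (u \<bullet> v)\<^sup>2 / (u \<bullet> u))"
        unfolding M_def
        by (rule lyapunov_equation_planar[OF bounded_linear.linear[OF J_lin]])
           (use perp char in \<open>simp_all only: J_def\<close>)
      also have "\<dots> \<le> \<tau> * D * (3 / 4 * (v \<bullet> v))"
        using small mult_neg_pos[OF \<tau> D] by (intro mult_left_mono_neg) linarith+
      finally show ?thesis .
    qed
    have "D * (v \<bullet> \<rho>) \<le> D * (norm v * norm \<rho>)"
      using D by (intro mult_left_mono norm_cauchy_schwarz) auto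
    moreover have "M v \<bullet> M \<rho> \<le> (N * norm v) * (N * norm \<rho>)"
      using norm_cauchy_schwarz[of "M v" "M \<rho>"] mult_mono[OF N(2)[of v] N(2)[of \<rho>]] N(1)
      by (smt (verit) mult_nonneg_nonneg norm_ge_zero)
    ultimately have "D * (v \<bullet> \<rho>) + M v \<bullet> M \<rho> \<le> b * norm v * norm \<rho>"
      by (simp add: b_def algebra_simps power2_eq_square)
    also have "\<dots> \<le> b * norm v * (\<epsilon> * norm v)"
      using b \<rho> by (intro mult_left_mono) auto
    also have "\<dots> = - \<tau> * D / 4 * (v \<bullet> v)"
      using b by (simp add: \<epsilon>_def field_simps dot_square_norm power2_eq_square)
    finally have rest: "D * (v \<bullet> \<rho>) + M v \<bullet> M \<rho> \<le> - \<tau> * D / 4 * (v \<bullet> v)" .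
    have "V' p (f p) = 2 * (D * (v \<bullet> J v) + M v \<bullet> M (J v)) + 2 * (D * (v \<bullet> \<rho>) + M v \<bullet> M \<rho>)"
      unfolding V'_def v_def[symmetric] fp
      by (simp add: inner_add_right algebra_simps linear_add[OF bounded_linear.linear[OF M_lin]])
    also have "\<dots> \<le> \<tau> * D * (v \<bullet> v)"
      using main rest by (simp add: algebra_simps)
    also have "\<dots> = - c * (b * (dist p q)\<^sup>2)"
      using b by (simp add: c_def v_def dist_norm power2_norm_eq_inner)
    also have "\<dots> \<le> - c * V p"
      using mult_left_mono[OF upper[of p], of c] c by simp
    finally show ?thesis .
  qed
  show ?thesis
    by (rule asymptotically_stable_on_if_Lyapunov_function
          [OF inv qS fq r(1) r(4) L V' D lower b upper c decay])
qed


section \<open>The price field and its first integral\<close>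

lemma has_derivative_vec_lambda:
  fixes f :: "'a::euclidean_space \<Rightarrow> 'n::finite \<Rightarrow> real"
  assumes "\<And>i. ((\<lambda>x. f x i) has_derivative (\<lambda>v. f' v i)) (at x within S)"
  shows "((\<lambda>x. \<chi> i. f x i) has_derivative (\<lambda>v. \<chi> i. f' v i)) (at x within S)"
  unfolding has_derivative_componentwise_within[of "\<lambda>x. \<chi> i. f x i"]
  using assms by (auto simp: Basis_vec_def simp flip: cart_eq_inner_axis)

lemma open_positive_prices: "open positive_prices"
  unfolding positive_prices_def forall_3
  by (intro open_Collect_conj open_Collect_less continuous_intros)

lemma demand_cost_pos:
  assumes "p \<in> positive_prices"
  shows "0 < p \<bullet> column h demand_matrix"
  using assms exhaust_3[of h]
  by (auto simp: positive_prices_def forall_3 inner_vec_def sum_3 column_def demand_matrix_def vector_3 add_pos_pos)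

lemma inner_matrix_vector_mult:
  fixes M :: "real^'n^'m"
  shows "p \<bullet> (M *v w) = (\<Sum>h\<in>UNIV. w $ h * (p \<bullet> column h M))"
  by (simp add: matrix_mult_sum inner_sum_right scalar_mult_eq_scaleR)

text \<open>Each consumer spends exactly the income \<open>p \<bullet> a\<^sub>h\<close>, because the income ratio is normalized by the
  cost \<open>p \<bullet> b\<^sub>h\<close> of the demanded bundle.\<close>

lemma Walras_law:
  assumes "p \<in> positive_prices"
  shows "p \<bullet> excess_demand A p = 0"
  using demand_cost_pos[OF assms]
  by (simp add: excess_demand_def inner_diff_right inner_matrix_vector_mult income_ratio_def ones_def
      less_imp_neq[symmetric])

definition income_ratio_derivative :: "real^3^3 \<Rightarrow> real^3 \<Rightarrow> real^3 \<Rightarrow> real^3" where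
  "income_ratio_derivative A p v = (\<chi> h.
     ((v \<bullet> column h A) * (p \<bullet> column h demand_matrix) - (p \<bullet> column h A) * (v \<bullet> column h demand_matrix))
       / (p \<bullet> column h demand_matrix)\<^sup>2)"

definition price_field_derivative :: "real \<Rightarrow> real^3^3 \<Rightarrow> real^3 \<Rightarrow> real^3 \<Rightarrow> real^3" where
  "price_field_derivative \<gamma> A p v = (\<chi> i.
     \<gamma> * (p $ i) powr (\<gamma> - 1) * v $ i * excess_demand A p $ i
     + (p $ i) powr \<gamma> * (demand_matrix *v income_ratio_derivative A p v) $ i)"

lemma excess_demand_has_derivative:
  assumes "p \<in> positive_prices"
  shows "(excess_demand A has_derivative (\<lambda>v. demand_matrix *v income_ratio_derivative A p v)) (at p)"
proof -
  have "(income_ratio A has_derivative income_ratio_derivative A p) (at p)"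
    unfolding income_ratio_def[abs_def] income_ratio_derivative_def[abs_def]
  proof (rule has_derivative_vec_lambda)
    fix h
    let ?b = "column h demand_matrix"
    have "p \<bullet> ?b \<noteq> 0" using demand_cost_pos[OF assms, of h] by simp
    then show "((\<lambda>p. (p \<bullet> column h A) / (p \<bullet> ?b)) has_derivative
        (\<lambda>v. ((v \<bullet> column h A) * (p \<bullet> ?b) - (p \<bullet> column h A) * (v \<bullet> ?b)) / (p \<bullet> ?b)\<^sup>2)) (at p)"
      by (auto intro!: derivative_eq_intros simp: field_simps power2_eq_square)
  qed
  then show ?thesis
    unfolding excess_demand_def[abs_def]
    using bounded_linear.has_derivative[OF matrix_vector_mul_bounded_linear[of demand_matrix]]
    by (auto intro!: derivative_eq_intros)
qed

lemma price_field_has_derivative: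
  assumes p: "p \<in> positive_prices"
  shows "(price_field \<gamma> A has_derivative price_field_derivative \<gamma> A p) (at p)"
  unfolding price_field_def[abs_def] price_field_derivative_def[abs_def]
proof (rule has_derivative_vec_lambda)
  fix i
  have pi: "0 < p $ i" using p by (simp add: positive_prices_def)
  have E: "((\<lambda>p. excess_demand A p $ i) has_derivative
      (\<lambda>v. (demand_matrix *v income_ratio_derivative A p v) $ i)) (at p)"
    by (rule bounded_linear.has_derivative[OF bounded_linear_vec_nth excess_demand_has_derivative[OF p]])
  have "((\<lambda>p. (p $ i) powr \<gamma>) has_derivative (\<lambda>v. \<gamma> * (p $ i) powr (\<gamma> - 1) * v $ i)) (at p)"
  proof -
    have "((\<lambda>s. s powr \<gamma>) has_derivative (*) (\<gamma> * (p $ i) powr (\<gamma> - 1))) (at (p $ i))"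
      using has_real_derivative_powr[OF pi, of \<gamma>] by (simp add: has_field_derivative_def)
    from has_derivative_compose[OF bounded_linear.has_derivative[OF bounded_linear_vec_nth has_derivative_ident] this]
    show ?thesis by simp
  qed
  from has_derivative_mult[OF this E]
  show "((\<lambda>p. (p $ i) powr \<gamma> * excess_demand A p $ i) has_derivative
      (\<lambda>v. \<gamma> * (p $ i) powr (\<gamma> - 1) * v $ i * excess_demand A p $ i
        + (p $ i) powr \<gamma> * (demand_matrix *v income_ratio_derivative A p v) $ i)) (at p)"
    by (rule has_derivative_eq_rhs) (simp add: algebra_simps)
qed

lemma continuous_on_price_field_derivative:
  "continuous_on positive_prices (\<lambda>p. price_field_derivative \<gamma> A p v)"
proof -
  have E: "continuous_on positive_prices (excess_demand A)"
    by (rule has_derivative_continuous_on)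
       (rule has_derivative_at_withinI[OF excess_demand_has_derivative])
  have "continuous_on positive_prices (\<lambda>p. income_ratio_derivative A p v)"
    unfolding income_ratio_derivative_def
    by (intro continuous_on_vec_lambda continuous_intros) (auto simp: less_imp_neq[OF demand_cost_pos, symmetric])
  then have "continuous_on positive_prices (\<lambda>p. demand_matrix *v income_ratio_derivative A p v)"
    by (rule bounded_linear.continuous_on[OF matrix_vector_mul_bounded_linear])
  then show ?thesis
    unfolding price_field_derivative_def
    by (intro continuous_on_vec_lambda continuous_intros E)
       (auto simp: positive_prices_def less_imp_neq[symmetric])
qed

text \<open>The gradient is written in one formula for all \<open>\<gamma>\<close>, using
  \<open>1 / p\<^sub>i = p\<^sub>i powr (1 - \<gamma>)\<close> for \<open>\<gamma> = 2\<close>. Its components are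
  multiples of \<open>p\<^sub>i powr (1 - \<gamma>)\<close>, which against the factor
  \<open>p\<^sub>i powr \<gamma>\<close> of the price field leaves \<open>p\<^sub>i\<close>, the weight in Walras'
  law.\<close>

lemma first_integral_has_derivative:
  assumes p: "p \<in> positive_prices"
  shows "(first_integral \<gamma> has_derivative
    (\<lambda>v. (if \<gamma> = 2 then p $ 1 * p $ 2 * p $ 3 else 2 - \<gamma>) * (\<Sum>i\<in>UNIV. (p $ i) powr (1 - \<gamma>) * v $ i))) (at p)"
proof -
  have pos: "0 < p $ i" for i using p by (simp add: positive_prices_def)
  have coord: "((\<lambda>p. p $ i) has_derivative (\<lambda>v. v $ i)) (at p)" for i
    by (rule bounded_linear.has_derivative[OF bounded_linear_vec_nth has_derivative_ident])
  have pow: "((\<lambda>p. (p $ i) powr (2 - \<gamma>)) has_derivative (\<lambda>v. (2 - \<gamma>) * (p $ i) powr (1 - \<gamma>) * v $ i)) (at p)" for i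
  proof -
    have "((\<lambda>s. s powr (2 - \<gamma>)) has_derivative (*) ((2 - \<gamma>) * (p $ i) powr (2 - \<gamma> - 1))) (at (p $ i))"
      using has_real_derivative_powr[OF pos, of "2 - \<gamma>"] by (simp add: has_field_derivative_def)
    from has_derivative_compose[OF coord this] show ?thesis by (simp add: algebra_simps)
  qed
  show ?thesis
  proof (cases "\<gamma> = 2")
    case True
    have inv: "(p $ i) powr (1 - \<gamma>) = 1 / p $ i" for i
      using pos[of i] True by (simp add: powr_minus_divide)
    have "((\<lambda>p. p $ 1 * p $ 2 * p $ 3) has_derivative
        (\<lambda>v. p $ 1 * p $ 2 * p $ 3 * (\<Sum>i\<in>UNIV. (p $ i) powr (1 - \<gamma>) * v $ i))) (at p)"
      unfolding inv sum_3
      by (rule has_derivative_eq_rhs[OF has_derivative_mult[OF has_derivative_mult[OF coord coord] coord]])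
         (use pos[of 1] pos[of 2] pos[of 3] in \<open>simp add: fun_eq_iff field_simps\<close>)
    then show ?thesis using True unfolding first_integral_def[abs_def] by simp
  next
    case False
    have "((\<lambda>p. (p $ 1) powr (2 - \<gamma>) + (p $ 2) powr (2 - \<gamma>) + (p $ 3) powr (2 - \<gamma>)) has_derivative
        (\<lambda>v. (2 - \<gamma>) * (\<Sum>i\<in>UNIV. (p $ i) powr (1 - \<gamma>) * v $ i))) (at p)"
      unfolding sum_3
      by (rule has_derivative_eq_rhs[OF has_derivative_add[OF has_derivative_add[OF pow pow] pow]])
         (simp add: algebra_simps)
    then show ?thesis using False unfolding first_integral_def[abs_def] by simp
  qed
qed

lemma invariant_price_surface:
  "invariant_under (price_field \<gamma> A) positive_prices (price_surface \<gamma>)"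
  unfolding invariant_under_def
proof (intro conjI allI impI ballI)
  show "price_surface \<gamma> \<subseteq> positive_prices" by (auto simp: price_surface_def)
  fix I x t
  assume "is_interval I \<and> 0 \<in> I \<and> ode_solution (price_field \<gamma> A) positive_prices I x \<and> x 0 \<in> price_surface \<gamma>"
  then have I: "is_interval I" "0 \<in> I" and x: "\<And>t. t \<in> I \<Longrightarrow> x t \<in> positive_prices"
      "\<And>t. t \<in> I \<Longrightarrow> (x has_vector_derivative price_field \<gamma> A (x t)) (at t within I)"
    and x0: "x 0 \<in> price_surface \<gamma>"
    unfolding ode_solution_def by blast+
  assume t: "t \<in> I"
  have "((\<lambda>t. first_integral \<gamma> (x t)) has_field_derivative 0) (at s within I)" if s: "s \<in> I" for s
  proof -
    let ?p = "x s"
    have "?p $ i powr (1 - \<gamma>) * price_field \<gamma> A ?p $ i = ?p $ i * excess_demand A ?p $ i" for i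
      using x(1)[OF s] by (simp add: price_field_def positive_prices_def abs_of_pos flip: mult.assoc powr_add)
    then have "(\<Sum>i\<in>UNIV. ?p $ i powr (1 - \<gamma>) * price_field \<gamma> A ?p $ i) = ?p \<bullet> excess_demand A ?p"
      by (simp add: inner_vec_def)
    then have orth: "(\<Sum>i\<in>UNIV. ?p $ i powr (1 - \<gamma>) * price_field \<gamma> A ?p $ i) = 0"
      using Walras_law[OF x(1)[OF s]] by simp
    show ?thesis
      using vector_derivative_diff_chain_within[OF x(2)[OF s]
          has_derivative_at_withinI[OF first_integral_has_derivative[OF x(1)[OF s], of \<gamma>]]]
      unfolding orth by (simp add: has_real_derivative_iff_has_vector_derivative o_def)
  qed
  then obtain c where "\<And>s. s \<in> I \<Longrightarrow> first_integral \<gamma> (x s) = c"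
    using has_field_derivative_zero_constant[of I "\<lambda>t. first_integral \<gamma> (x t)"] is_interval_convex[OF I(1)] by blast
  then show "x t \<in> price_surface \<gamma>"
    using x0 x(1)[OF t] t I(2) by (simp add: price_surface_def)
qed


section \<open>Linearization at the fixed point\<close>

lemma demand_cost_ones: "ones \<bullet> column h demand_matrix = 2"
  using exhaust_3[of h]
  by (auto simp: inner_vec_def sum_3 column_def demand_matrix_def ones_def vector_3)

lemma endowment_value_ones:
  assumes "ones v* A = ones"
  shows "ones \<bullet> column h A = 1"
proof -
  have "(ones v* A) $ h = ones \<bullet> column h A"
    by (simp add: vector_matrix_mult_def inner_vec_def column_def mult.commute)
  then show ?thesis by (simp add: assms) (simp add: ones_def)
qed

lemma excess_demand_ones:
  assumes "A *v ones = ones" and "ones v* A = ones"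
  shows "excess_demand A ones = 0"
proof -
  have "income_ratio A ones = (1 / 2) *\<^sub>R ones"
    by (simp add: vec_eq_iff income_ratio_def demand_cost_ones endowment_value_ones[OF assms(2)])
       (simp add: ones_def)
  moreover have "demand_matrix *v ones = 2 *\<^sub>R ones"
    by (simp add: vec_eq_iff forall_3 matrix_vector_mult_def sum_3 demand_matrix_def ones_def vector_3)
  ultimately show ?thesis
    by (simp add: excess_demand_def assms(1) matrix_vector_mult_scaleR)
qed

text \<open>The general real matrix whose rows and columns sum to zero, in terms of its upper left
  \<open>2 \<times> 2\<close> block; four free entries keep the polynomial identities below small.\<close>

definition zero_sum_map :: "real \<Rightarrow> real \<Rightarrow> real \<Rightarrow> real \<Rightarrow> real^3 \<Rightarrow> real^3" where
  "zero_sum_map a b c d v = vector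
    [a * v $ 1 + b * v $ 2 - (a + b) * v $ 3,
     c * v $ 1 + d * v $ 2 - (c + d) * v $ 3,
     (a + b + c + d) * v $ 3 - (a + c) * v $ 1 - (b + d) * v $ 2]"

lemma inner_ones_zero_sum_map: "ones \<bullet> zero_sum_map a b c d v = 0"
  by (simp add: zero_sum_map_def inner_vec_def sum_3 vector_3 ones_def algebra_simps)

text \<open>The trace of the matrix is \<open>2a + b + c + 2d\<close>, and its three principal \<open>2 \<times> 2\<close>
  minors all equal \<open>ad - bc\<close>, so their sum \<open>3 (ad - bc)\<close> is the determinant on the plane
  orthogonal to \<open>ones\<close>. There the identity is Cayley-Hamilton, and along \<open>ones\<close> both sides
  vanish.\<close>

lemma Cayley_Hamilton_zero_sum_map:
  fixes a b c d :: real
  defines "C \<equiv> zero_sum_map a b c d"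
  shows "C (C v) = (2 * a + b + c + 2 * d) *\<^sub>R C v
    - (3 * (a * d - b * c)) *\<^sub>R (v - ((ones \<bullet> v) / (ones \<bullet> ones)) *\<^sub>R ones)"
proof -
  have u: "ones \<bullet> v = v $ 1 + v $ 2 + v $ 3" "ones \<bullet> (ones :: real^3) = 3"
    by (simp_all add: inner_vec_def sum_3 ones_def)
  show ?thesis
    unfolding u C_def zero_sum_map_def
    by (simp add: vec_eq_iff forall_3 vector_3 ones_def) (simp add: field_simps)
qed

lemma zero_sum_map_scaleR: "zero_sum_map a b c d (k *\<^sub>R v) = k *\<^sub>R zero_sum_map a b c d v"
  by (simp add: zero_sum_map_def vec_eq_iff forall_3 vector_3 algebra_simps)

text \<open>The sum of all three income derivatives vanishes, so component \<open>i\<close> of the derivative is minus the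
  \<open>i\<close>-th of them, \<open>- v \<bullet> (2 a\<^sub>i - b\<^sub>i) / 4\<close>; the parameters are the
  upper left block of the transpose of \<open>2A - B\<close>.\<close>

lemma price_field_derivative_ones:
  fixes d1 d2 d3 K L :: real
  defines "A \<equiv> endowment_matrix d1 d2 d3 K L"
  assumes "d1 + d2 + d3 + K + L = 1" and "A *v ones = ones" and "ones v* A = ones"
  shows "price_field_derivative \<gamma> A ones v
    = (- 1 / 4) *\<^sub>R zero_sum_map (2 * d1) (2 * d3 + 2 * K - 1) (2 * d3 + 2 * L - 1) (2 * d2) v"
proof -
  define c where "c = zero_sum_map (2 * d1) (2 * d3 + 2 * K - 1) (2 * d3 + 2 * L - 1) (2 * d2) v"
  have sum: "c $ 1 + c $ 2 + c $ 3 = 0"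
    using inner_ones_zero_sum_map by (simp add: c_def inner_vec_def sum_3 ones_def)
  have A: "v \<bullet> column 1 A = d1 * v $ 1 + (d3 + K) * v $ 2 + (d2 + L) * v $ 3"
    "v \<bullet> column 2 A = (d3 + L) * v $ 1 + d2 * v $ 2 + (d1 + K) * v $ 3"
    "v \<bullet> column 3 A = (d2 + K) * v $ 1 + (d1 + L) * v $ 2 + d3 * v $ 3"
    by (simp_all add: A_def inner_vec_def sum_3 column_def endowment_matrix_def vector_3 mult.commute)
  have B: "v \<bullet> column 1 demand_matrix = v $ 2 + v $ 3"
    "v \<bullet> column 2 demand_matrix = v $ 1 + v $ 3"
    "v \<bullet> column 3 demand_matrix = v $ 1 + v $ 2"
    by (simp_all add: inner_vec_def sum_3 column_def demand_matrix_def vector_3)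
  have L: "L = 1 - d1 - d2 - d3 - K" using assms(2) by simp
  have "2 * (v \<bullet> column h A) - v \<bullet> column h demand_matrix = c $ h" for h
  proof -
    have "\<forall>h. 2 * (v \<bullet> column h A) - v \<bullet> column h demand_matrix = c $ h"
      unfolding forall_3 A B c_def zero_sum_map_def vector_3 L by (simp add: algebra_simps)
    then show ?thesis ..
  qed
  then have "income_ratio_derivative A ones v = (1 / 4) *\<^sub>R c"
    by (simp add: income_ratio_derivative_def demand_cost_ones endowment_value_ones[OF assms(4)]
        vec_eq_iff mult.commute)
  moreover have "demand_matrix *v c = - c"
    using sum by (simp add: vec_eq_iff forall_3 matrix_vector_mult_def sum_3 demand_matrix_def vector_3)
  ultimately have "demand_matrix *v income_ratio_derivative A ones v = (- 1 / 4) *\<^sub>R c"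
    by (simp add: matrix_vector_mult_scaleR)
  then show ?thesis
    unfolding c_def[symmetric]
    by (simp add: price_field_derivative_def excess_demand_ones[OF assms(3,4)] vec_eq_iff)
       (simp add: ones_def)
qed

theorem theorem3:
  fixes A :: "real^3^3" and d1 d2 d3 K L \<gamma> :: real
  assumes "A = endowment_matrix d1 d2 d3 K L"
    and "A *v ones = ones" and "ones v* A = ones"
    and "d1 + d2 + d3 + K + L = 1"
    and "d1 \<ge> 0" and "d2 \<ge> 0" and "d3 \<ge> 0"
    and "d1 + d2 + d3 > 0"
    and "4 * (d1 * d2 + d2 * d3 + d3 * d1) - (d1 + d2 + d3)\<^sup>2 + (K - L)\<^sup>2 > 0"
    and "\<gamma> \<ge> 0"
  shows "asymptotically_stable_on (price_field \<gamma> A) positive_prices (price_surface \<gamma>) ones"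
proof -
  define s where "s = d1 + d2 + d3"
  define H where "H = 4 * (d1 * d2 + d2 * d3 + d3 * d1) - (d1 + d2 + d3)\<^sup>2 + (K - L)\<^sup>2"
  let ?J = "price_field_derivative \<gamma> A ones"
  define C where "C = zero_sum_map (2 * d1) (2 * d3 + 2 * K - 1) (2 * d3 + 2 * L - 1) (2 * d2)"
  have J: "?J v = (- 1 / 4) *\<^sub>R C v" for v
    unfolding C_def assms(1)
    by (rule price_field_derivative_ones) (use assms in simp_all)
  have JJ: "?J (?J v) = (1 / 16) *\<^sub>R C (C v)" for v
    unfolding J C_def zero_sum_map_scaleR by simp
  have trace: "2 * (2 * d1) + (2 * d3 + 2 * K - 1) + (2 * d3 + 2 * L - 1) + 2 * (2 * d2) = 2 * s"
    using assms(4) by (simp add: s_def)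
  have L: "L = 1 - d1 - d2 - d3 - K" using assms(4) by simp
  have minor: "2 * d1 * (2 * d2) - (2 * d3 + 2 * K - 1) * (2 * d3 + 2 * L - 1) = H"
    unfolding L H_def by (simp add: power2_eq_square algebra_simps)
  have ones: "ones \<in> positive_prices" by (simp add: positive_prices_def ones_def)
  show ?thesis
  proof (rule asymptotically_stable_on_level_set_if_planar_linearization)
    show "invariant_under (price_field \<gamma> A) positive_prices (price_surface \<gamma>)"
      by (rule invariant_price_surface)
    show "ones \<in> price_surface \<gamma>" using ones by (simp add: price_surface_def)
    show "price_field \<gamma> A ones = 0"
      by (simp add: vec_eq_iff price_field_def excess_demand_ones[OF assms(2,3)])
    show "open positive_prices" by (rule open_positive_prices)
    show "(price_field \<gamma> A has_derivative price_field_derivative \<gamma> A p) (at p)"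
      if "p \<in> positive_prices" for p
      using that by (rule price_field_has_derivative)
    show "continuous_on positive_prices (\<lambda>p. price_field_derivative \<gamma> A p v)" for v
      by (rule continuous_on_price_field_derivative)
    show "first_integral \<gamma> p = first_integral \<gamma> ones" if "p \<in> price_surface \<gamma>" for p
      using that by (simp add: price_surface_def)
    show "(first_integral \<gamma> has_derivative (\<lambda>v. (if \<gamma> = 2 then 1 else 2 - \<gamma>) * (ones \<bullet> v))) (at ones)"
      using first_integral_has_derivative[OF ones, of \<gamma>]
      by (rule has_derivative_eq_rhs) (simp add: fun_eq_iff inner_vec_def ones_def)
    show "(if \<gamma> = 2 then 1 else 2 - \<gamma>) \<noteq> 0" by simp
    show "(ones :: real^3) \<noteq> 0" by (simp add: vec_eq_iff ones_def)
    show "ones \<bullet> ?J v = 0" for v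
      by (simp add: J C_def inner_ones_zero_sum_map)
    show "?J (?J v) = (- s / 2) *\<^sub>R ?J v
        - (3 / 16 * H) *\<^sub>R (v - ((ones \<bullet> v) / (ones \<bullet> ones)) *\<^sub>R ones)" for v
    proof -
      define w where "w = v - ((ones \<bullet> v) / (ones \<bullet> ones)) *\<^sub>R ones"
      have "C (C v) = (2 * s) *\<^sub>R C v - (3 * H) *\<^sub>R w"
        using Cayley_Hamilton_zero_sum_map[of "2 * d1" "2 * d3 + 2 * K - 1" "2 * d3 + 2 * L - 1" "2 * d2" v]
        unfolding C_def[symmetric] w_def[symmetric] trace minor .
      then show ?thesis
        unfolding JJ unfolding J w_def[symmetric] by (simp add: scaleR_diff_right)
    qed
    show "- s / 2 < 0" using assms(8) by (simp add: s_def)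
    show "0 < 3 / 16 * H" using assms(9) by (simp add: H_def)
  qed
qed

end
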